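(* Let $G$ be an unbalanced split graph without isolated vertices, with degree sequence $\pi$, and let $[\alpha|\beta]=[\alpha(\pi)|\beta(\pi)]$ be the corresponding $S$-block. Then $G$ is an NG-1 graph if and only if the last (smallest) part of the partition $\beta$ is $1$, and $G$ is an NG-2 graph if and only if the last (smallest) part of the partition $\alpha$ is at least $2$.
   Context: Graphs are finite and simple, with at least one vertex. Degree sequences are written $\pi=(d_1\ge\dots\ge d_r)$. $\alpha(\pi)$ is the partition with $i$-th part $d_i-i+1$ for those $i$ with $d_i\ge i$ (row lengths of the Ferrers diagram starting at and including the main diagonal); $\beta(\pi)$ is the partition with $j$-th part $|\{i:d_i\ge j\}|-j$ for those $j$ for which this is positive (column lengths below the main diagonal). Both have distinct parts. An $S$-block is a pair $[\alpha|\beta]$ of partitions of the same integer into distinct parts such that $\beta$ majorizes $\alpha$ (every partial sum $\sum_{i\le m}\beta_i\ge\sum_{i\le m}\alpha_i$, for $m$ up to the minimum of the lengths) and the length of $\alpha$ equals that of $\beta$ or one more; $[\alpha(\pi)|\beta(\pi)]$ is an $S$-block whenever $\pi$ is the degree sequence of a split graph. A split graph is a graph with a partition $V(G)=K\cup S$ with $K$ a clique and $S$ a stable set ($KS$-partition; either part may be empty). It is balanced if it has a $KS$-partition in which simultaneously $|K|$ is the size of a largest clique and $|S|$ the size of a largest stable set; otherwise it is unbalanced. A graph $G$ is an NG-graph (Nordhaus–Gaddum graph) if $\chi(G)+\chi(\overline G)=|V(G)|+1$, where $\chi$ is the chromatic number and $\overline G$ the complement. Let $A_G=\{v\in V(G):\deg(v)=\chi(G)-1\}$.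 For an NG-graph, $A_G$ is nonempty and the induced subgraph $G[A_G]$ is a clique, a stable set, or a 5-cycle. An NG-graph $G$ is an NG-1 graph if $G[A_G]$ is a clique, an NG-2 graph if $G[A_G]$ is a stable set, and an NG-3 graph if $G[A_G]$ is a 5-cycle. *)

theory Defs
  imports "Graph_Theory.Pair_Digraph" "HOL-Library.Multiset"
begin

text \<open>
  A finite simple graph is a \<^locale>\<open>pair_graph\<close>: a finite, symmetric and loop-free set of
  arcs, with each undirected edge represented by its two arcs. The degree of a vertex is
  therefore its \<^const>\<open>out_degree\<close>.
\<close>

subsection \<open>Cliques, stable sets and colourings\<close>

definition clique :: "'a pair_pre_digraph \<Rightarrow> 'a set \<Rightarrow> bool" where
  "clique G C \<longleftrightarrow> C \<subseteq> pverts G \<and> (\<forall>u\<in>C. \<forall>v\<in>C. u \<noteq> v \<longrightarrow> (u, v) \<in> parcs G)"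

definition stable :: "'a pair_pre_digraph \<Rightarrow> 'a set \<Rightarrow> bool" where
  "stable G S \<longleftrightarrow> S \<subseteq> pverts G \<and> (\<forall>u\<in>S. \<forall>v\<in>S. (u, v) \<notin> parcs G)"

definition clique_number :: "'a pair_pre_digraph \<Rightarrow> nat" where
  "clique_number G = Max (card ` {C. clique G C})"

definition stability_number :: "'a pair_pre_digraph \<Rightarrow> nat" where
  "stability_number G = Max (card ` {S. stable G S})"

definition graph_complement :: "'a pair_pre_digraph \<Rightarrow> 'a pair_pre_digraph" where
  "graph_complement G =
     \<lparr> pverts = pverts G,
       parcs = {(u, v). u \<in> pverts G \<and> v \<in> pverts G \<and> u \<noteq> v \<and> (u, v) \<notin> parcs G} \<rparr>"

definition proper_colouring :: "'a pair_pre_digraph \<Rightarrow> nat \<Rightarrow> ('a \<Rightarrow> nat) \<Rightarrow> bool" where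
  "proper_colouring G k c \<longleftrightarrow>
     c ` pverts G \<subseteq> {..<k} \<and> (\<forall>(u, v) \<in> parcs G. c u \<noteq> c v)"

definition chromatic_number :: "'a pair_pre_digraph \<Rightarrow> nat" where
  "chromatic_number G = (LEAST k. \<exists>c. proper_colouring G k c)"

subsection \<open>Split graphs\<close>

definition KS_partition :: "'a pair_pre_digraph \<Rightarrow> 'a set \<Rightarrow> 'a set \<Rightarrow> bool" where
  "KS_partition G K S \<longleftrightarrow>
     K \<union> S = pverts G \<and> K \<inter> S = {} \<and> clique G K \<and> stable G S"

definition split_graph :: "'a pair_pre_digraph \<Rightarrow> bool" where
  "split_graph G \<longleftrightarrow> (\<exists>K S. KS_partition G K S)"

definition balanced_split_graph :: "'a pair_pre_digraph \<Rightarrow> bool" where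
  "balanced_split_graph G \<longleftrightarrow>
     (\<exists>K S. KS_partition G K S \<and> card K = clique_number G \<and> card S = stability_number G)"

definition unbalanced_split_graph :: "'a pair_pre_digraph \<Rightarrow> bool" where
  "unbalanced_split_graph G \<longleftrightarrow> split_graph G \<and> \<not> balanced_split_graph G"

subsection \<open>Nordhaus--Gaddum graphs\<close>

definition NG_graph :: "'a pair_pre_digraph \<Rightarrow> bool" where
  "NG_graph G \<longleftrightarrow>
     chromatic_number G + chromatic_number (graph_complement G) = card (pverts G) + 1"

text \<open>
  The defining condition \<open>deg v = \<chi>(G) - 1\<close> is written additively, which avoids truncated
  subtraction.
\<close>

definition NG_set :: "'a pair_pre_digraph \<Rightarrow> 'a set" where
  "NG_set G = {v \<in> pverts G. out_degree G v + 1 = chromatic_number G}"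

text \<open>
  A one-element set is both a clique and a stable set, so a graph can be both an NG-1 and an
  NG-2 graph.
\<close>

definition NG1_graph :: "'a pair_pre_digraph \<Rightarrow> bool" where
  "NG1_graph G \<longleftrightarrow> NG_graph G \<and> clique G (NG_set G)"

definition NG2_graph :: "'a pair_pre_digraph \<Rightarrow> bool" where
  "NG2_graph G \<longleftrightarrow> NG_graph G \<and> stable G (NG_set G)"

subsection \<open>Degree sequences and their block of partitions\<close>

definition degree_sequence :: "'a pair_pre_digraph \<Rightarrow> nat list" where
  "degree_sequence G =
     rev (sorted_list_of_multiset (image_mset (out_degree G) (mset_set (pverts G))))"

text \<open>
  Below, \<open>i\<close> and \<open>j\<close> count from 1 as in the Ferrers diagram, so that \<open>d\<^sub>i\<close> is \<open>\<pi> ! (i - 1)\<close>.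
  No \<open>j > length \<pi>\<close> can contribute to \<open>\<beta>(\<pi>)\<close>. For weakly decreasing \<open>\<pi>\<close> both lists
  are strictly decreasing, so the smallest part is the last entry. If \<open>\<pi>\<close> is the degree
  sequence of a nonempty graph without isolated vertices, both lists are nonempty.
\<close>

definition alpha_partition :: "nat list \<Rightarrow> nat list" where
  "alpha_partition \<pi> =
     [\<pi> ! (i - 1) + 1 - i. i \<leftarrow> [1..<length \<pi> + 1], i \<le> \<pi> ! (i - 1)]"

definition beta_partition :: "nat list \<Rightarrow> nat list" where
  "beta_partition \<pi> =
     [card {i \<in> {1..length \<pi>}. j \<le> \<pi> ! (i - 1)} - j.
        j \<leftarrow> [1..<length \<pi> + 1], j < card {i \<in> {1..length \<pi>}. j \<le> \<pi> ! (i - 1)}]"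

text \<open>
  \<open>[\<alpha>|\<beta>]\<close> is an \<open>S\<close>-block. Partitions are lists of positive parts in decreasing order, here
  strictly decreasing because the parts are distinct.
\<close>

definition S_block :: "nat list \<times> nat list \<Rightarrow> bool" where
  "S_block = (\<lambda>(\<alpha>, \<beta>).
     sorted_wrt (>) \<alpha> \<and> sorted_wrt (>) \<beta> \<and> 0 \<notin> set \<alpha> \<and> 0 \<notin> set \<beta> \<and>
     sum_list \<alpha> = sum_list \<beta> \<and>
     (\<forall>m \<le> min (length \<alpha>) (length \<beta>). sum_list (take m \<alpha>) \<le> sum_list (take m \<beta>)) \<and>
     (length \<alpha> = length \<beta> \<or> length \<alpha> = length \<beta> + 1))"

text \<open>
  The pair \<open>[\<alpha>(\<pi>)|\<beta>(\<pi>)]\<close> is defined for every \<open>\<pi>\<close>; it satisfies \<^const>\<open>S_block\<close> whenever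
  \<open>\<pi>\<close> is the degree sequence of a split graph.
\<close>

definition degree_block :: "nat list \<Rightarrow> nat list \<times> nat list" where
  "degree_block \<pi> = (alpha_partition \<pi>, beta_partition \<pi>)"

end

theory Submission
  imports Defs
begin

text \<open>
  An unbalanced split graph has a \<^emph>\<open>swing vertex\<close> \<open>v\<close>: its vertex set is covered by a clique
  \<open>K\<close> and a stable set \<open>T\<close> that overlap exactly in \<open>v\<close> (\<open>unbalanced_imp_overlapping_cover\<close>).
  Everything follows from such a cover. Write \<open>k\<close> for the size of \<open>K\<close> and \<open>A\<close> for the set of
  vertices of degree \<open>\<chi>(G) - 1\<close>.

  Giving all of \<open>T\<close> the colour of \<open>v\<close> extends a rainbow colouring of \<open>K\<close> to the graph, so
  \<open>\<chi>(G) = k\<close>. Complementation exchanges \<open>K\<close> and \<open>T\<close>, so the chromatic number of the complement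
  is the size of \<open>T\<close>. These sizes sum to one more than the number of vertices, as \<open>v\<close> is counted
  twice. Hence the graph is always an NG-graph, and only the shape of \<open>A\<close> matters.

  Vertices of \<open>K\<close> have degree at least \<open>k - 1\<close>, and vertices of \<open>T\<close> have degree at most \<open>k - 1\<close>
  because their neighbours lie in \<open>K - {v}\<close>. Thus \<open>v \<in> A\<close>, and comparing the other members of
  \<open>A\<close> with \<open>v\<close> shows that \<open>A\<close> is a clique iff \<open>A \<subseteq> K\<close>, and a stable set iff \<open>A \<inter> K = {v}\<close>.

  On the side of partitions, exactly the vertices of \<open>K \<union> A\<close> have degree at least \<open>k - 1\<close>, and
  exactly those of \<open>K - A\<close> have degree at least \<open>k\<close>. So column \<open>k - 1\<close> of the Ferrers diagram
  has at least \<open>k\<close> cells and column \<open>k\<close> at most \<open>k - 1\<close>; hence both partitions have their last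
  part at index \<open>k - 1\<close>, which is at least 1 since \<open>v\<close> is not isolated. The last part of \<open>\<beta>\<close>
  is \<open>|K \<union> A| - (k - 1)\<close>, which is 1 iff \<open>A \<subseteq> K\<close>; the last part of \<open>\<alpha>\<close> is
  \<open>d\<^sub>k\<^sub>-\<^sub>1 - k + 2\<close>, which is at least 2 iff at least \<open>k - 1\<close> vertices have degree at least \<open>k\<close>,
  that is, iff \<open>A\<close> meets \<open>K\<close> only in \<open>v\<close>.
\<close>

section \<open>Overlapping covers of unbalanced split graphs\<close>

definition overlapping_cover :: "'a pair_pre_digraph \<Rightarrow> 'a set \<Rightarrow> 'a set \<Rightarrow> 'a \<Rightarrow> bool" where
  "overlapping_cover G K T v \<longleftrightarrow>
     clique G K \<and> stable G T \<and> K \<union> T = pverts G \<and> K \<inter> T = {v}"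

lemma clique_Int_stable:
  assumes "clique G C" and "stable G S" and "x \<in> C \<inter> S" and "y \<in> C \<inter> S"
  shows "x = y"
  using assms unfolding clique_def stable_def by blast

lemma card_le_oneI:
  assumes "\<And>x y. x \<in> A \<Longrightarrow> y \<in> A \<Longrightarrow> x = y"
  shows "card A \<le> 1"
  using assms by (metis card_le_Suc0_iff_eq One_nat_def card.infinite zero_le)

text \<open>
  Inside \<open>X\<close> the set \<open>Z\<close> has at most as many elements as \<open>X\<close>, and outside at most one, so being
  larger forces both bounds to be attained. This is applied both to a clique and to a stable set
  that outgrow their side of a \<open>KS\<close>-partition.
\<close>

lemma larger_set_eq_insert:
  assumes "finite X" and "finite Z" and "Z \<subseteq> X \<union> Y" and "X \<inter> Y = {}"
    and "card X < card Z" and le: "card (Z \<inter> Y) \<le> 1"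
  obtains y where "y \<in> Y" and "Z = insert y X"
proof -
  have split: "Z = (Z \<inter> X) \<union> (Z \<inter> Y)" using assms(3) by blast
  have "card Z = card (Z \<inter> X) + card (Z \<inter> Y)"
    by (subst split, rule card_Un_disjoint) (use assms in auto)
  moreover have "card (Z \<inter> X) \<le> card X" using assms(1) by (simp add: card_mono)
  ultimately have "card (Z \<inter> Y) = 1" and "card X \<le> card (Z \<inter> X)" using assms(5) le by linarith+
  from this(1) obtain y where y: "Z \<inter> Y = {y}" by (auto simp: card_1_singleton_iff)
  have "Z \<inter> X = X" using \<open>card X \<le> card (Z \<inter> X)\<close> assms(1) by (intro card_seteq) auto
  with split y have "Z = insert y X" by blast
  with y that show thesis by blast
qed

lemma unbalanced_imp_overlapping_cover:
  assumes fin: "finite (pverts G)" and "unbalanced_split_graph G"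
  obtains K T v where "overlapping_cover G K T v"
proof -
  obtain K S where KS: "KS_partition G K S"
    and nb: "card K \<noteq> clique_number G \<or> card S \<noteq> stability_number G"
    using assms(2) unfolding unbalanced_split_graph_def split_graph_def balanced_split_graph_def
    by blast
  then have part: "K \<union> S = pverts G" "K \<inter> S = {}" and K: "clique G K" and S: "stable G S"
    unfolding KS_partition_def by auto
  have "{C. clique G C} \<subseteq> Pow (pverts G)" "{C. stable G C} \<subseteq> Pow (pverts G)"
    unfolding clique_def stable_def by auto
  then have fins: "finite (card ` {C. clique G C})" "finite (card ` {C. stable G C})"
    using fin by (meson finite_Pow_iff finite_imageI finite_subset)+
  have finKS: "finite K" "finite S" using part(1) fin by (metis finite_Un)+
  from nb show thesis
  proof
    assume "card K \<noteq> clique_number G"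
    moreover have "card K \<le> clique_number G"
      unfolding clique_number_def using fins(1) K by (intro Max_ge) auto
    moreover have "clique_number G \<in> card ` {C. clique G C}"
      unfolding clique_number_def using fins(1) K by (intro Max_in) auto
    ultimately obtain C where C: "clique G C" "card K < card C" by force
    then have "C \<subseteq> K \<union> S" unfolding part(1) clique_def by blast
    moreover have "card (C \<inter> S) \<le> 1"
      using clique_Int_stable[OF C(1) S] by (intro card_le_oneI)
    ultimately obtain s where "s \<in> S" "C = insert s K"
      using larger_set_eq_insert[of K C S] finKS C(2) part(2)
      by (metis finite_Un finite_subset)
    then have "overlapping_cover G C S s"
      unfolding overlapping_cover_def using C(1) S part by auto
    then show thesis by (rule that)
  next
    assume "card S \<noteq> stability_number G"
    moreover have "card S \<le> stability_number G"
      unfolding stability_number_def using fins(2) S by (intro Max_ge) auto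
    moreover have "stability_number G \<in> card ` {C. stable G C}"
      unfolding stability_number_def using fins(2) S by (intro Max_in) auto
    ultimately obtain T where T: "stable G T" "card S < card T" by force
    then have "T \<subseteq> S \<union> K" unfolding Un_commute[of S] part(1) stable_def by blast
    moreover have "card (T \<inter> K) \<le> 1"
      using clique_Int_stable[OF K T(1)] by (intro card_le_oneI) blast
    ultimately obtain u where "u \<in> K" "T = insert u S"
      using larger_set_eq_insert[of S T K] finKS T(2) part(2)
      by (metis finite_Un finite_subset Int_commute)
    then have "overlapping_cover G K T u"
      unfolding overlapping_cover_def using T(1) K part by auto
    then show thesis by (rule that)
  qed
qed

section \<open>Chromatic numbers and the NG property\<close>

lemma clique_card_le_colours:
  assumes "clique G K" and "proper_colouring G n c"
  shows "card K \<le> n"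
proof -
  have "inj_on c K" using assms unfolding clique_def proper_colouring_def inj_on_def by blast
  moreover have "c ` K \<subseteq> {..<n}" using assms unfolding clique_def proper_colouring_def by blast
  ultimately show ?thesis by (metis card_inj_on_le card_lessThan finite_lessThan)
qed

text \<open>
  The stable set costs no further colour: all its vertices share the colour of \<open>v\<close>, and \<open>v\<close> is
  the only vertex of the clique with that colour.
\<close>

lemma chromatic_number_overlapping_cover:
  assumes fin: "finite (pverts G)" and arcs: "parcs G \<subseteq> pverts G \<times> pverts G"
    and loopfree: "\<And>x. (x, x) \<notin> parcs G" and cover: "overlapping_cover G K T v"
  shows "chromatic_number G = card K"
  unfolding chromatic_number_def
proof (rule Least_equality)
  have K: "K \<subseteq> pverts G" and KT: "K \<union> T = pverts G" "v \<in> K" "v \<in> T"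
    and T: "\<And>x y. x \<in> T \<Longrightarrow> y \<in> T \<Longrightarrow> (x, y) \<notin> parcs G"
    using cover unfolding overlapping_cover_def clique_def stable_def by auto
  obtain f where f: "bij_betw f K {0..<card K}"
    using ex_bij_betw_finite_nat finite_subset[OF K fin] by blast
  define c where "c x = (if x \<in> K then f x else f v)" for x
  have in_range: "f x < card K" if "x \<in> K" for x
    using f that by (auto simp: bij_betw_def)
  have inj: "x = y" if "x \<in> K" "y \<in> K" "f x = f y" for x y
    using f that by (auto simp: bij_betw_def inj_on_def)
  have "c x \<noteq> c y" if xy: "(x, y) \<in> parcs G" for x y
  proof
    assume eq: "c x = c y"
    have mem: "x \<in> K \<union> T" "y \<in> K \<union> T" using xy arcs KT(1) by auto
    have "(x \<in> K \<and> y \<in> K \<longrightarrow> x = y) \<and> (x \<notin> K \<and> y \<in> K \<longrightarrow> y = v) \<and> (x \<in> K \<and> y \<notin> K \<longrightarrow> x = v)"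
      using eq inj KT(2) unfolding c_def by metis
    with mem KT(3) have "x = y \<or> x \<in> T \<and> y \<in> T" by blast
    with xy loopfree T show False by blast
  qed
  moreover have "c ` pverts G \<subseteq> {..<card K}" using in_range KT(2) by (auto simp: c_def)
  ultimately have "proper_colouring G (card K) c" unfolding proper_colouring_def by blast
  then show "\<exists>c. proper_colouring G (card K) c" by blast
next
  fix n assume "\<exists>c. proper_colouring G n c"
  then show "card K \<le> n"
    using clique_card_le_colours cover unfolding overlapping_cover_def by blast
qed

lemma overlapping_cover_complement:
  assumes "overlapping_cover G K T v"
  shows "overlapping_cover (graph_complement G) T K v"
  using assms
  unfolding overlapping_cover_def clique_def stable_def graph_complement_def by auto

lemma pair_graph_simple:
  assumes "pair_graph G"
  shows "finite (pverts G)" and "parcs G \<subseteq> pverts G \<times> pverts G" and "(x, x) \<notin> parcs G"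
    and "(x, y) \<in> parcs G \<Longrightarrow> (y, x) \<in> parcs G"
proof -
  interpret pair_graph G by fact
  show "finite (pverts G)" by (rule pair_finite_verts)
  show "parcs G \<subseteq> pverts G \<times> pverts G" using in_arcsD1 in_arcsD2 by auto
  show "(x, x) \<notin> parcs G" using pair_no_loops by force
  show "(x, y) \<in> parcs G \<Longrightarrow> (y, x) \<in> parcs G" by (simp add: arcs_symmetric)
qed

lemma overlapping_cover_imp_NG_graph:
  assumes "pair_graph G" and cover: "overlapping_cover G K T v"
  shows "NG_graph G"
proof -
  note simple = pair_graph_simple[OF assms(1)]
  have "chromatic_number G = card K"
    by (rule chromatic_number_overlapping_cover[OF _ _ _ cover]) (use simple in auto)
  moreover have "chromatic_number (graph_complement G) = card T"
    by (rule chromatic_number_overlapping_cover[OF _ _ _ overlapping_cover_complement[OF cover]])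
      (use simple(1) in \<open>auto simp: graph_complement_def\<close>)
  moreover have "card K + card T = card (pverts G) + 1"
    using cover card_Un_Int[of K T] simple(1) unfolding overlapping_cover_def
    by (metis card_1_singleton_iff One_nat_def finite_Un)
  ultimately show ?thesis unfolding NG_graph_def by simp
qed

section \<open>Degrees around the swing vertex\<close>

lemma out_degree_eq_card_neighbours:
  "out_degree (with_proj G) x = card {y. (x, y) \<in> parcs G}"
proof -
  have "out_arcs (with_proj G) x = Pair x ` {y. (x, y) \<in> parcs G}"
    by (auto simp: out_arcs_def)
  then show ?thesis unfolding out_degree_def by (simp add: card_image inj_on_def)
qed

lemma degrees_overlapping_cover:
  assumes "pair_graph G" and cover: "overlapping_cover G K T v"
  shows "x \<in> K \<Longrightarrow> card K \<le> out_degree G x + 1"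
    and "x \<in> T \<Longrightarrow> out_degree G x + 1 \<le> card K"
    and "out_degree G v + 1 = card K"
proof -
  note simple = pair_graph_simple[OF assms(1)]
  have K: "clique G K" and T: "stable G T" and KT: "K \<union> T = pverts G" "v \<in> K" "v \<in> T"
    using cover unfolding overlapping_cover_def by auto
  have finK: "finite K" using simple(1) KT(1) by (metis finite_Un)
  show ge: "card K \<le> out_degree G x + 1" if "x \<in> K" for x
  proof -
    have "{y. (x, y) \<in> parcs G} \<subseteq> pverts G" using simple(2) by auto
    moreover have "K - {x} \<subseteq> {y. (x, y) \<in> parcs G}" using K that unfolding clique_def by auto
    ultimately have "card (K - {x}) \<le> out_degree G x"
      unfolding out_degree_eq_card_neighbours using simple(1) by (meson card_mono finite_subset)
    with that finK show ?thesis by simp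
  qed
  show le: "out_degree G x + 1 \<le> card K" if "x \<in> T" for x
  proof -
    have "{y. (x, y) \<in> parcs G} \<subseteq> K - {v}"
      using simple(2) T that KT unfolding stable_def by blast
    then have "out_degree G x \<le> card (K - {v})"
      unfolding out_degree_eq_card_neighbours using finK by (simp add: card_mono)
    moreover have "0 < card K" using finK KT(2) card_gt_0_iff by blast
    ultimately show ?thesis using KT(2) finK by simp
  qed
  show "out_degree G v + 1 = card K" using ge[OF KT(2)] le[OF KT(3)] by (rule antisym[rotated])
qed

text \<open>
  The vertex \<open>v\<close> decides both questions: it is adjacent to all other vertices of \<open>K\<close> and to no
  vertex of \<open>T\<close>, so its presence in the set excludes the other vertices of one side.
\<close>

lemma NG_set_clique_or_stable:
  assumes "pair_graph G" and cover: "overlapping_cover G K T v"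
  shows "v \<in> NG_set G"
    and "clique G (NG_set G) \<longleftrightarrow> NG_set G \<subseteq> K"
    and "stable G (NG_set G) \<longleftrightarrow> NG_set G \<inter> K = {v}"
proof -
  note simple = pair_graph_simple[OF assms(1)]
  have K: "clique G K" and T: "stable G T" and KT: "K \<union> T = pverts G" "K \<inter> T = {v}"
    using cover unfolding overlapping_cover_def by auto
  have "chromatic_number G = card K"
    by (rule chromatic_number_overlapping_cover[OF _ _ _ cover]) (use simple in auto)
  then show v: "v \<in> NG_set G"
    using degrees_overlapping_cover(3)[OF assms] KT unfolding NG_set_def by auto
  have sub: "NG_set G \<subseteq> K \<union> T" unfolding NG_set_def KT(1) by auto
  show "clique G (NG_set G) \<longleftrightarrow> NG_set G \<subseteq> K"
  proof
    assume "clique G (NG_set G)"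
    then show "NG_set G \<subseteq> K" using v sub T KT(2) unfolding clique_def stable_def by blast
  next
    assume "NG_set G \<subseteq> K"
    then show "clique G (NG_set G)" using K unfolding clique_def by blast
  qed
  show "stable G (NG_set G) \<longleftrightarrow> NG_set G \<inter> K = {v}"
  proof
    assume "stable G (NG_set G)"
    then show "NG_set G \<inter> K = {v}" using v K KT(2) unfolding clique_def stable_def by blast
  next
    assume "NG_set G \<inter> K = {v}"
    then have "NG_set G \<subseteq> T" using sub KT(2) by blast
    then show "stable G (NG_set G)" using T unfolding stable_def by blast
  qed
qed

lemma vertices_of_degree_ge:
  assumes "pair_graph G" and cover: "overlapping_cover G K T v"
  shows "{x \<in> pverts G. card K \<le> out_degree G x} = K - NG_set G"
    and "{x \<in> pverts G. card K - 1 \<le> out_degree G x} = K \<union> NG_set G"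
proof -
  note simple = pair_graph_simple[OF assms(1)]
  note deg = degrees_overlapping_cover[OF assms]
  have KT: "K \<union> T = pverts G" using cover unfolding overlapping_cover_def by auto
  have chi: "chromatic_number G = card K"
    by (rule chromatic_number_overlapping_cover[OF _ _ _ cover]) (use simple in auto)
  show "{x \<in> pverts G. card K \<le> out_degree G x} = K - NG_set G"
    unfolding NG_set_def chi KT[symmetric] using deg(1,2) by fastforce
  show "{x \<in> pverts G. card K - 1 \<le> out_degree G x} = K \<union> NG_set G"
    unfolding NG_set_def chi KT[symmetric] using deg(1,2) by fastforce
qed

section \<open>Last parts of the block of partitions\<close>

text \<open>
  Both partitions are list comprehensions over an interval of indices, so their last part belongs
  to the largest index that passes the filter.
\<close>

lemma last_filtered_interval:
  assumes "a \<le> m" and "m < b" and "P m" and "\<And>j. m < j \<Longrightarrow> j < b \<Longrightarrow> \<not> P j"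
  shows "last [f j. j \<leftarrow> [a..<b], P j] = f m"
proof -
  have "[a..<b] = [a..<m] @ m # [Suc m..<b]"
    using assms(1,2) by (metis le_Suc_ex less_imp_le upt_add_eq_append upt_conv_Cons)
  moreover have "concat (map (\<lambda>j. if P j then [f j] else []) [Suc m..<b]) = []"
    using assms(4) by auto
  ultimately show ?thesis using assms(3) by simp
qed

abbreviation conjugate_part :: "nat list \<Rightarrow> nat \<Rightarrow> nat" where
  "conjugate_part \<pi> j \<equiv> card {i \<in> {1..length \<pi>}. j \<le> \<pi> ! (i - 1)}"

lemma conjugate_part_antimono: "j \<le> j' \<Longrightarrow> conjugate_part \<pi> j' \<le> conjugate_part \<pi> j"
  by (rule card_mono) auto

lemma conjugate_part_le_length: "conjugate_part \<pi> j \<le> length \<pi>"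
proof -
  have "conjugate_part \<pi> j \<le> card {1..length \<pi>}" by (rule card_mono) auto
  then show ?thesis by simp
qed

text \<open>
  Both sides say that the cell in row \<open>i\<close> and column \<open>j\<close> lies in the Ferrers diagram, because
  each column of the diagram of a weakly decreasing list is an initial segment of the rows.
\<close>

lemma le_nth_iff_le_conjugate_part:
  assumes sorted: "sorted_wrt (\<ge>) \<pi>" and i: "1 \<le> i" "i \<le> length \<pi>"
  shows "j \<le> \<pi> ! (i - 1) \<longleftrightarrow> i \<le> conjugate_part \<pi> j"
proof
  have mono: "\<pi> ! q \<le> \<pi> ! p" if "p \<le> q" "q < length \<pi>" for p q
    using sorted that by (cases "p = q") (auto simp: sorted_wrt_iff_nth_less)
  {
    assume "j \<le> \<pi> ! (i - 1)"
    moreover have "\<pi> ! (i - 1) \<le> \<pi> ! (i' - 1)" if "i' \<in> {1..i}" for i'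
      using that i by (intro mono) auto
    ultimately have "{1..i} \<subseteq> {i \<in> {1..length \<pi>}. j \<le> \<pi> ! (i - 1)}"
      using i by fastforce
    then have "card {1..i} \<le> conjugate_part \<pi> j" by (intro card_mono) auto
    then show "i \<le> conjugate_part \<pi> j" by simp
  }
  {
    assume le: "i \<le> conjugate_part \<pi> j"
    show "j \<le> \<pi> ! (i - 1)"
    proof (rule ccontr)
      assume no: "\<not> j \<le> \<pi> ! (i - 1)"
      have "i' < i" if "i' \<in> {1..length \<pi>}" "j \<le> \<pi> ! (i' - 1)" for i'
      proof (rule ccontr)
        assume "\<not> i' < i"
        then have "\<pi> ! (i' - 1) \<le> \<pi> ! (i - 1)" using that(1) i by (intro mono) auto
        with no that(2) show False by simp
      qed
      then have "conjugate_part \<pi> j \<le> card {1..<i}" by (intro card_mono) auto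
      with le i show False by simp
    qed
  }
qed

text \<open>
  The bounds on columns \<open>m\<close> and \<open>m + 1\<close> locate the last part: column lengths weakly decrease, so
  no later column reaches below the diagonal, and no later row reaches the diagonal.
\<close>

lemma last_beta_partition:
  assumes "1 \<le> m" and "m < conjugate_part \<pi> m" and "conjugate_part \<pi> (m + 1) \<le> m"
  shows "last (beta_partition \<pi>) = conjugate_part \<pi> m - m"
  unfolding beta_partition_def
proof (rule last_filtered_interval)
  show "m < length \<pi> + 1" using assms(2) conjugate_part_le_length[of \<pi> m] by linarith
next
  fix j assume "m < j"
  then have "conjugate_part \<pi> j \<le> conjugate_part \<pi> (m + 1)"
    by (intro conjugate_part_antimono) simp
  with assms(3) \<open>m < j\<close> show "\<not> j < conjugate_part \<pi> j" by linarith
qed (use assms in auto)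

lemma last_alpha_partition:
  assumes sorted: "sorted_wrt (\<ge>) \<pi>"
    and "1 \<le> m" and "m \<le> conjugate_part \<pi> m" and "conjugate_part \<pi> (m + 1) \<le> m"
  shows "last (alpha_partition \<pi>) = \<pi> ! (m - 1) + 1 - m"
  unfolding alpha_partition_def
proof (rule last_filtered_interval)
  have len: "m \<le> length \<pi>" using assms(3) conjugate_part_le_length[of \<pi> m] by linarith
  then show "m < length \<pi> + 1" by simp
  show "m \<le> \<pi> ! (m - 1)"
    using le_nth_iff_le_conjugate_part[OF sorted assms(2) len] assms(3) by simp
next
  fix j assume j: "m < j" "j < length \<pi> + 1"
  then have "conjugate_part \<pi> j \<le> conjugate_part \<pi> (m + 1)"
    by (intro conjugate_part_antimono) simp
  with assms(4) j have "\<not> j \<le> conjugate_part \<pi> j" by linarith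
  then show "\<not> j \<le> \<pi> ! (j - 1)"
    using le_nth_iff_le_conjugate_part[OF sorted, of j j] j by simp
qed (use assms in auto)

lemma sorted_degree_sequence: "sorted_wrt (\<ge>) (degree_sequence G)"
  by (simp add: degree_sequence_def sorted_wrt_rev)

lemma conjugate_part_degree_sequence:
  assumes "finite (pverts G)"
  shows "conjugate_part (degree_sequence G) j = card {x \<in> pverts G. j \<le> out_degree G x}"
proof -
  let ?\<pi> = "degree_sequence G"
  have "{i \<in> {1..length ?\<pi>}. j \<le> ?\<pi> ! (i - 1)} = Suc ` {i. i < length ?\<pi> \<and> j \<le> ?\<pi> ! i}"
    (is "?L = ?R")
  proof (rule set_eqI)
    fix i show "i \<in> ?L \<longleftrightarrow> i \<in> ?R" by (cases i) auto
  qed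
  then have "conjugate_part ?\<pi> j = length (filter ((\<le>) j) ?\<pi>)"
    by (simp add: card_image length_filter_conv_card)
  also have "\<dots> = size (filter_mset ((\<le>) j) (mset ?\<pi>))"
    by (metis mset_filter size_mset)
  also have "mset ?\<pi> = image_mset (out_degree G) (mset_set (pverts G))"
    by (simp add: degree_sequence_def)
  also have "size (filter_mset ((\<le>) j) \<dots>) = card {x \<in> pverts G. j \<le> out_degree G x}"
    using assms by (simp add: filter_mset_image_mset)
  finally show ?thesis .
qed

section \<open>Recognising NG-1 and NG-2 graphs\<close>

theorem theorem4p18:
  fixes G :: "'a pair_pre_digraph" and \<pi> \<alpha> \<beta> :: "nat list"
  assumes "pair_graph G" and "pverts G \<noteq> {}"
    and "unbalanced_split_graph G"
    and "\<forall>v \<in> pverts G. out_degree G v \<noteq> 0"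
    and "\<pi> = degree_sequence G"
    and "(\<alpha>, \<beta>) = degree_block \<pi>"
  shows "(NG1_graph G \<longleftrightarrow> last \<beta> = 1) \<and> (NG2_graph G \<longleftrightarrow> last \<alpha> \<ge> 2)"
proof -
  note fin = pair_graph_simple(1)[OF assms(1)]
  obtain K T v where cover: "overlapping_cover G K T v"
    using unbalanced_imp_overlapping_cover[OF fin assms(3)] .
  then have v: "v \<in> K" "v \<in> pverts G" and K: "K \<subseteq> pverts G"
    unfolding overlapping_cover_def by auto
  note A = NG_set_clique_or_stable[OF assms(1) cover]
  have NG: "NG_graph G" using overlapping_cover_imp_NG_graph[OF assms(1) cover] .
  have finK: "finite K" and finA: "finite (NG_set G)"
    using K fin finite_subset by (auto simp: NG_set_def)
  define m where "m = card K - 1"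
  \<comment> \<open>Without isolated vertices the swing vertex has a neighbour, so the index is in range.\<close>
  have m: "1 \<le> m" "card K = m + 1"
    using degrees_overlapping_cover(3)[OF assms(1) cover] assms(4) v(2)
    by (auto simp: m_def Suc_le_eq)
  have c_m: "conjugate_part \<pi> m = card (K \<union> NG_set G)"
    using vertices_of_degree_ge(2)[OF assms(1) cover]
    unfolding assms(5) conjugate_part_degree_sequence[OF fin] m_def by simp
  have c_Suc: "conjugate_part \<pi> (m + 1) = card (K - NG_set G)"
    using vertices_of_degree_ge(1)[OF assms(1) cover]
    unfolding assms(5) conjugate_part_degree_sequence[OF fin] m(2)[symmetric] by simp
  have gt: "m < conjugate_part \<pi> m"
    using card_mono[of "K \<union> NG_set G" K] finK finA m(2) unfolding c_m by simp
  have split_K: "card (K - NG_set G) + card (NG_set G \<inter> K) = m + 1"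
    using finK m(2) card_Diff_subset_Int[of K "NG_set G"] card_mono[of K "K \<inter> NG_set G"]
    by (simp add: Int_commute)
  have A_K: "1 \<le> card (NG_set G \<inter> K)"
    using A(1) v(1) finK by (metis IntI Suc_leI One_nat_def card_gt_0_iff empty_iff finite_Int)
  then have le: "conjugate_part \<pi> (m + 1) \<le> m" using split_K c_Suc by linarith
  have ab: "\<alpha> = alpha_partition \<pi>" "\<beta> = beta_partition \<pi>"
    using assms(6) by (simp_all add: degree_block_def)
  have "last \<beta> = card (K \<union> NG_set G) - m"
    using last_beta_partition[OF m(1) gt le] unfolding ab c_m .
  then have "last \<beta> = 1 \<longleftrightarrow> card (K \<union> NG_set G) = card K"
    using gt m(2) unfolding c_m by linarith
  also have "\<dots> \<longleftrightarrow> NG_set G \<subseteq> K"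
    using finK finA card_subset_eq[of "K \<union> NG_set G" K] by (metis Un_upper1 Un_upper2 finite_UnI
      sup.absorb1)
  finally have beta: "last \<beta> = 1 \<longleftrightarrow> NG_set G \<subseteq> K" .
  have sorted: "sorted_wrt (\<ge>) \<pi>" unfolding assms(5) by (rule sorted_degree_sequence)
  have "last \<alpha> = \<pi> ! (m - 1) + 1 - m"
    using last_alpha_partition[OF sorted m(1) less_imp_le[OF gt] le] unfolding ab .
  then have "2 \<le> last \<alpha> \<longleftrightarrow> m + 1 \<le> \<pi> ! (m - 1)" by auto
  also have "\<dots> \<longleftrightarrow> m \<le> conjugate_part \<pi> (m + 1)"
    using gt conjugate_part_le_length[of \<pi> m]
    by (intro le_nth_iff_le_conjugate_part[OF sorted m(1)]) linarith
  also have "\<dots> \<longleftrightarrow> card (NG_set G \<inter> K) = 1"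
    unfolding c_Suc using split_K A_K by linarith
  also have "\<dots> \<longleftrightarrow> NG_set G \<inter> K = {v}"
    using A(1) v(1) by (metis IntI One_nat_def card_1_singleton_iff singletonD)
  finally have alpha: "2 \<le> last \<alpha> \<longleftrightarrow> NG_set G \<inter> K = {v}" .
  show ?thesis
    unfolding NG1_graph_def NG2_graph_def using NG A(2,3) alpha beta by simp
qed

end
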